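(* Let $N\ge 3$, $d\ge 1$ be integers, $\tau>0$, $\lambda\ge 0$, and let $(\psi_{ij})_{i,j\in[N]}$ be constant real communication weights such that $$\sum_{j\neq i}\psi_{ij}=1\quad\text{for all } i\in[N],\qquad \psi_{ij}>0\quad\text{for all } i\neq j.$$ Assume $\lambda\tau\le 1$. Let $x_i^0\in C^1([-\tau,0];\mathbb{R}^d)$, $i\in[N]$, and let $x=(x_1,\dots,x_N)$ be the solution of $$\dot x_i(t)=\sum_{j\neq i}\psi_{ij}\bigl(x_j(t-\tau)+\lambda\tau\,\dot x_j(t-\tau)-x_i(t)\bigr),\qquad i\in[N],\ t>0,$$ with initial datum $x_i(t)=x_i^0(t)$ for $t\in[-\tau,0]$, $i\in[N]$. Put $d_x(t):=\max_{i,j\in[N]}|x_i(t)-x_j(t)|$. Assume that there exist $T_0>0$ and fixed indices $I,J\in[N]$ such that $$d_x(t)=|x_I(t)-x_J(t)|\quad\text{for all } t\ge T_0.$$ Then the solution converges to a consensus state, i.e., $\lim_{t\to\infty}d_x(t)=0$.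
   Context: $[N]:=\{1,\dots,N\}$; $|\cdot|$ is the Euclidean norm on $\mathbb{R}^d$. A solution is a continuous function $x:[-\tau,\infty)\to(\mathbb{R}^d)^N$ that equals the initial datum on $[-\tau,0]$, is continuously differentiable on each interval $[k\tau,(k+1)\tau]$, $k=0,1,2,\dots$ (one-sided derivatives at the endpoints), and satisfies the differential equation on each such interval, with the one-sided derivatives taken from within the interval (and $\dot x_j(t-\tau)$ taken correspondingly). Such a solution exists globally and is unique for every $C^1$ initial datum. *)

theory Defs
  imports "HOL-Analysis.Analysis"
begin

text \<open>
  Continuous differentiability on an interval, with one-sided derivatives at the endpoints.
  The library's \<open>C1_differentiable_on\<close> asks for two-sided derivatives at all points.
\<close>

definition C1_within :: "real set \<Rightarrow> (real \<Rightarrow> 'a::real_normed_vector) \<Rightarrow> bool" where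
  "C1_within S f \<longleftrightarrow>
     (\<exists>f'. (\<forall>t\<in>S. (f has_vector_derivative f' t) (at t within S)) \<and> continuous_on S f')"

text \<open>
  Agents are indexed by \<open>{1..N}\<close>; values of \<open>x\<close>, \<open>x0\<close> and \<open>\<psi>\<close> at other indices, the diagonal
  of \<open>\<psi>\<close>, and the values of \<open>x i\<close> before time \<open>- \<tau>\<close> are irrelevant.
  For \<open>t\<close> in the \<open>k\<close>-th interval, the delayed derivative at \<open>t - \<tau>\<close> is taken from within
  the preceding interval, which for \<open>k = 0\<close> is \<open>{- \<tau>..0}\<close>, where \<open>x\<close> is the initial datum.
\<close>

definition is_solution ::
  "nat \<Rightarrow> real \<Rightarrow> real \<Rightarrow> (nat \<Rightarrow> nat \<Rightarrow> real) \<Rightarrow>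
   (nat \<Rightarrow> real \<Rightarrow> real ^ 'd) \<Rightarrow> (nat \<Rightarrow> real \<Rightarrow> real ^ 'd) \<Rightarrow> bool" where
  "is_solution N \<tau> lam \<psi> x0 x \<longleftrightarrow>
     (\<forall>i\<in>{1..N}.
        continuous_on {- \<tau>..} (x i) \<and>
        (\<forall>t\<in>{- \<tau>..0}. x i t = x0 i t) \<and>
        (\<forall>k::nat.
           C1_within {real k * \<tau>..(real k + 1) * \<tau>} (x i) \<and>
           (\<forall>t\<in>{real k * \<tau>..(real k + 1) * \<tau>}.
              (x i has_vector_derivative
                 (\<Sum>j\<in>{1..N} - {i}. \<psi> i j *\<^sub>R
                    (x j (t - \<tau>)
                     + (lam * \<tau>) *\<^sub>R
                         vector_derivative (x j) (at (t - \<tau>) within {(real k - 1) * \<tau>..real k * \<tau>})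
                     - x i t)))
              (at t within {real k * \<tau>..(real k + 1) * \<tau>}))))"

definition d_x :: "nat \<Rightarrow> (nat \<Rightarrow> real \<Rightarrow> real ^ 'd) \<Rightarrow> real \<Rightarrow> real" where
  "d_x N x t = Max ((\<lambda>(i, j). norm (x i t - x j t)) ` ({1..N} \<times> {1..N}))"

end

theory Submission
  imports Defs
begin

text \<open>
  Put \<open>\<sigma> = \<lambda>\<tau>\<close>, \<open>y\<^sub>i = x\<^sub>i + \<sigma> x\<^sub>i'\<close> and \<open>u\<^sub>i(t) = \<Sum>\<^sub>j \<psi>\<^sub>i\<^sub>j y\<^sub>j(t - \<tau>)\<close>. The equation says
  \<open>x\<^sub>i' = u\<^sub>i - x\<^sub>i\<close>, hence \<open>y\<^sub>i = (1 - \<sigma>) x\<^sub>i + \<sigma> u\<^sub>i\<close> is a convex combination when \<open>\<sigma> \<le> 1\<close>.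
  As \<open>N \<ge> 3\<close>, any two rows of \<open>\<psi>\<close> charge a common index, so passing from \<open>y\<close> to \<open>u\<close> contracts
  diameters by a fixed factor \<open>\<theta>\<^sup>2 < 1\<close>. On each delay interval \<open>x\<^sub>i - x\<^sub>j\<close> relaxes exponentially
  towards \<open>u\<^sub>i - u\<^sub>j\<close>, and the diameters of \<open>x\<close> and \<open>y\<close> decay geometrically from one interval to
  the next.
\<close>

text \<open>The integrating factor \<open>exp (s - a)\<close> turns the equation into
  \<open>w' = exp (s - a) *\<^sub>R g\<close>, whose norm is dominated by the derivative of
  \<open>exp (s - a) * G\<close>. The mean value inequality then compares the two
  increments.\<close>

lemma relaxation_bound:
  fixes z g :: "real \<Rightarrow> 'a::real_normed_vector"
  assumes deriv: "\<And>t. t \<in> {a..b} \<Longrightarrow> (z has_vector_derivative g t - z t) (at t within {a..b})"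
    and bound: "\<And>t. t \<in> {a..b} \<Longrightarrow> norm (g t) \<le> G"
    and t: "t \<in> {a..b}"
  shows "norm (z t) \<le> exp (a - t) * norm (z a) + (1 - exp (a - t)) * G"
proof (cases "a = t")
  case True
  then show ?thesis by simp
next
  case False
  with t have at: "a < t" by simp
  define w where "w s = exp (s - a) *\<^sub>R z s" for s
  define \<phi> where "\<phi> s = exp (s - a) * G" for s
  have w': "(w has_vector_derivative exp (s - a) *\<^sub>R g s) (at s within {a..b})"
    if "s \<in> {a..b}" for s
    unfolding w_def
    by (rule derivative_eq_intros deriv[OF that] refl | simp add: algebra_simps)+
  have \<phi>': "(\<phi> has_vector_derivative exp (s - a) * G) (at s within S)" for s S
    unfolding \<phi>_def has_real_derivative_iff_has_vector_derivative[symmetric]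
    by (auto intro!: derivative_eq_intros)
  have "norm (w t - w a) \<le> \<phi> t - \<phi> a"
  proof (rule differentiable_bound_general[OF at])
    have "continuous_on {a..b} w"
      using w' has_vector_derivative_continuous continuous_on_eq_continuous_within by blast
    then show "continuous_on {a..t} w"
      by (rule continuous_on_subset) (use t in auto)
    show "continuous_on {a..t} \<phi>"
      unfolding \<phi>_def by (intro continuous_intros)
    fix s assume s: "a < s" "s < t"
    have "at s within {a..b} = at s"
      using s t by (intro at_within_interior) auto
    with w'[of s] s t show "(w has_vector_derivative exp (s - a) *\<^sub>R g s) (at s)"
      by simp
    show "(\<phi> has_vector_derivative exp (s - a) * G) (at s)"
      by (rule \<phi>')
    show "norm (exp (s - a) *\<^sub>R g s) \<le> exp (s - a) * G"
      using bound[of s] s t by simp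
  qed
  then have "norm (w t) \<le> norm (w a) + (\<phi> t - \<phi> a)"
    by (smt (verit) norm_triangle_ineq2)
  then have "exp (t - a) * norm (z t) \<le> norm (z a) + (exp (t - a) - 1) * G"
    by (simp add: w_def \<phi>_def algebra_simps)
  then have "exp (a - t) * (exp (t - a) * norm (z t))
      \<le> exp (a - t) * (norm (z a) + (exp (t - a) - 1) * G)"
    by (intro mult_left_mono) auto
  moreover have "exp (a - t) * exp (t - a) = 1"
    by (simp flip: exp_add)
  ultimately show ?thesis
    by (simp add: algebra_simps flip: mult.assoc)
qed

text \<open>Both averages are integrated against the product weight \<open>p k * q l\<close>, whose diagonal does not contribute.\<close>
lemma weighted_average_diff_bound:
  fixes y :: "'i \<Rightarrow> 'a::real_normed_vector"
  assumes "finite A" and "sum p A = 1" and "sum q A = 1"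
    and p: "\<And>k. k \<in> A \<Longrightarrow> p k \<ge> 0" and q: "\<And>k. k \<in> A \<Longrightarrow> q k \<ge> 0"
    and m: "m \<in> A" "p m \<ge> e" "q m \<ge> e" "e \<ge> 0"
    and D: "\<And>k l. k \<in> A \<Longrightarrow> l \<in> A \<Longrightarrow> norm (y k - y l) \<le> D"
  shows "norm ((\<Sum>k\<in>A. p k *\<^sub>R y k) - (\<Sum>k\<in>A. q k *\<^sub>R y k)) \<le> (1 - e\<^sup>2) * D"
proof -
  have D0: "D \<ge> 0" using D[OF m(1) m(1)] by simp
  have total: "(\<Sum>(k, l)\<in>A \<times> A. p k * q l) = 1"
    by (simp add: assms(2,3) flip: sum.cartesian_product sum_distrib_left)
  have "(\<Sum>k\<in>A. p k *\<^sub>R y k) = (\<Sum>(k, l)\<in>A \<times> A. (p k * q l) *\<^sub>R y k)"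
    by (simp add: assms(3) flip: sum.cartesian_product sum_distrib_left scaleR_left.sum)
  moreover have "(\<Sum>l\<in>A. q l *\<^sub>R y l) = (\<Sum>(k, l)\<in>A \<times> A. (p k * q l) *\<^sub>R y l)"
    by (subst sum.cartesian_product[symmetric], subst sum.swap)
      (simp add: assms(2) flip: sum_distrib_right scaleR_left.sum)
  ultimately have "norm ((\<Sum>k\<in>A. p k *\<^sub>R y k) - (\<Sum>k\<in>A. q k *\<^sub>R y k))
      = norm (\<Sum>(k, l)\<in>A \<times> A. (p k * q l) *\<^sub>R (y k - y l))"
    by (simp add: scaleR_diff_right sum_subtractf case_prod_unfold)
  also have "\<dots> \<le> (\<Sum>(k, l)\<in>A \<times> A. p k * q l * norm (y k - y l))"
    by (rule order_trans[OF norm_sum]) (auto simp: p q intro!: sum_mono)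
  also have "\<dots> = (\<Sum>(k, l)\<in>A \<times> A - {(m, m)}. p k * q l * norm (y k - y l))"
    using assms(1) m(1) by (intro sum.mono_neutral_right) auto
  also have "\<dots> \<le> (\<Sum>(k, l)\<in>A \<times> A - {(m, m)}. p k * q l * D)"
    by (intro sum_mono) (auto simp: p q D intro!: mult_left_mono)
  \<comment> \<open>The weights of all pairs add up to 1, so dropping \<open>(m, m)\<close> costs
    exactly \<open>p m * q m\<close>; this is the whole gain over the trivial bound
    \<open>D\<close>.\<close>
  also have "\<dots> = (1 - p m * q m) * D"
    using total assms(1) m(1)
    by (simp add: sum_diff1 case_prod_unfold flip: sum_distrib_right)
  also have "\<dots> \<le> (1 - e\<^sup>2) * D"
    using m D0 by (intro mult_right_mono) (auto simp: power2_eq_square intro!: mult_mono)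
  finally show ?thesis .
qed

text \<open>Three indices leave room for an \<open>m\<close> different from both \<open>i\<close>
  and \<open>j\<close>, and each of the two rows puts weight at least \<open>e\<close> on
  it.\<close>

lemma off_diagonal_average_diff_bound:
  fixes y :: "nat \<Rightarrow> 'a::real_normed_vector"
  assumes "N \<ge> 3"
    and row: "\<forall>i\<in>{1..N}. (\<Sum>j\<in>{1..N} - {i}. \<psi> i j) = 1"
    and low: "\<And>i j. i \<in> {1..N} \<Longrightarrow> j \<in> {1..N} \<Longrightarrow> i \<noteq> j \<Longrightarrow> \<psi> i j \<ge> e"
    and e: "0 < e" "e \<le> 1"
    and D: "\<And>k l. k \<in> {1..N} \<Longrightarrow> l \<in> {1..N} \<Longrightarrow> norm (y k - y l) \<le> D"
    and ij: "i \<in> {1..N}" "j \<in> {1..N}"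
  shows "norm ((\<Sum>k\<in>{1..N} - {i}. \<psi> i k *\<^sub>R y k) - (\<Sum>k\<in>{1..N} - {j}. \<psi> j k *\<^sub>R y k))
    \<le> (1 - e\<^sup>2) * D"
proof -
  \<comment> \<open>Extending every row by zero on the diagonal lets both averages run over the same
    index set.\<close>
  define P where "P a k = (if k = a then 0 else \<psi> a k)" for a k
  have \<psi>_sum: "(\<Sum>k\<in>{1..N} - {a}. \<psi> a k *\<^sub>R y k) = (\<Sum>k\<in>{1..N}. P a k *\<^sub>R y k)" for a
    by (rule sum.mono_neutral_cong_left) (auto simp: P_def)
  have "(\<Sum>k\<in>{1..N}. P a k) = (\<Sum>k\<in>{1..N} - {a}. \<psi> a k)" for a
    by (rule sum.mono_neutral_cong_right) (auto simp: P_def)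
  then have P1: "sum (P a) {1..N} = 1" if "a \<in> {1..N}" for a
    using row that by simp
  have P0: "P a k \<ge> 0" if "a \<in> {1..N}" "k \<in> {1..N}" for a k
    using low[of a k] that e by (auto simp: P_def)
  obtain m where m: "m \<in> {1..N}" "m \<noteq> i" "m \<noteq> j"
  proof -
    have "card ({1..N} - {i, j}) \<ge> card {1..N} - card {i, j}"
      by (intro diff_card_le_card_Diff) auto
    moreover have "card {i, j} \<le> 2" by (simp add: card_insert_if)
    ultimately have "{1..N} - {i, j} \<noteq> {}"
      using \<open>N \<ge> 3\<close> by (metis card.empty card_atLeastAtMost diff_Suc_1 diff_is_0_eq
          le_antisym le_trans not_less_eq_eq numeral_2_eq_2 numeral_3_eq_3 le_zero_eq)
    then show ?thesis using that by blast
  qed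
  show ?thesis
    unfolding \<psi>_sum
    by (rule weighted_average_diff_bound[where m = m])
      (use P1 P0 ij m low e D in \<open>auto simp: P_def\<close>)
qed

theorem theorem1:
  fixes N :: nat and \<tau> lam T0 :: real and \<psi> :: "nat \<Rightarrow> nat \<Rightarrow> real"
    and x0 x :: "nat \<Rightarrow> real \<Rightarrow> real ^ 'd" and I J :: nat
  assumes "N \<ge> 3" and "\<tau> > 0" and "lam \<ge> 0"
    and "\<forall>i\<in>{1..N}. (\<Sum>j\<in>{1..N} - {i}. \<psi> i j) = 1"
    and "\<forall>i\<in>{1..N}. \<forall>j\<in>{1..N}. i \<noteq> j \<longrightarrow> \<psi> i j > 0"
    and "lam * \<tau> \<le> 1"
    and "\<forall>i\<in>{1..N}. C1_within {- \<tau>..0} (x0 i)"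
    and "is_solution N \<tau> lam \<psi> x0 x"
    and "T0 > 0" and "I \<in> {1..N}" and "J \<in> {1..N}"
    and "\<forall>t\<ge>T0. d_x N x t = norm (x I t - x J t)"
  shows "(d_x N x \<longlongrightarrow> 0) at_top"
proof -

  \<comment> \<open>The equation on one delay interval\<close>
  define \<sigma> where "\<sigma> = lam * \<tau>"
  have \<sigma>: "0 \<le> \<sigma>" "\<sigma> \<le> 1" using assms(2,3,6) by (auto simp: \<sigma>_def)
  let ?V = "{1..N}"
  let ?K = "\<lambda>n::nat. {real n * \<tau>..(real n + 1) * \<tau>}"
  \<comment> \<open>The derivative of \<open>x j\<close> may jump at multiples of \<tau>, so the
    value depends on the interval it is taken from. \<open>Y n\<close> belongs to the interval
    ending at \<open>real n * \<tau>\<close>: \<open>Y 0\<close> comes from the initial datum, and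
    on \<open>?K n\<close> the matching function is \<open>Y (Suc n)\<close>.\<close>
  define Y where "Y n j t = x j t + \<sigma> *\<^sub>R
      vector_derivative (x j) (at t within {(real n - 1) * \<tau>..real n * \<tau>})" for n j t
  define U where "U n i t = (\<Sum>j\<in>?V - {i}. \<psi> i j *\<^sub>R Y n j (t - \<tau>))" for n i t
  have x': "(x i has_vector_derivative U n i t - x i t) (at t within ?K n)"
    if "i \<in> ?V" "t \<in> ?K n" for i n t
  proof -
    have "(\<Sum>j\<in>?V - {i}. \<psi> i j *\<^sub>R (Y n j (t - \<tau>) - x i t)) = U n i t - x i t"
      using assms(4) that(1)
      by (simp add: U_def scaleR_diff_right sum_subtractf flip: scaleR_left.sum)
    with assms(8) that show ?thesis
      unfolding is_solution_def Y_def \<sigma>_def by fastforce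
  qed
  have Y_Suc: "Y (Suc n) i t = (1 - \<sigma>) *\<^sub>R x i t + \<sigma> *\<^sub>R U n i t"
    if "i \<in> ?V" "t \<in> ?K n" for i n t
  proof -
    \<comment> \<open>Nondegeneracy of the interval makes the derivative within it unique.\<close>
    have "real n * \<tau> < (real n + 1) * \<tau>" using \<open>\<tau> > 0\<close> by simp
    then have "vector_derivative (x i) (at t within ?K n) = U n i t - x i t"
      using vector_derivative_within_closed_interval[OF _ that(2) x'[OF that]] by simp
    then have "Y (Suc n) i t = x i t + \<sigma> *\<^sub>R (U n i t - x i t)"
      by (simp add: Y_def add.commute)
    then show ?thesis
      by (simp add: algebra_simps)
  qed

  \<comment> \<open>Contraction of diameters by averaging\<close>
  obtain e where e: "0 < e" "e \<le> 1"
    and low: "\<And>i j. i \<in> ?V \<Longrightarrow> j \<in> ?V \<Longrightarrow> i \<noteq> j \<Longrightarrow> \<psi> i j \<ge> e"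
  proof -
    \<comment> \<open>The extra element 1 forces \<open>e \<le> 1\<close>.\<close>
    let ?S = "insert 1 ((\<lambda>(i, j). \<psi> i j) ` (?V \<times> ?V - Id))"
    have fin: "finite ?S" by simp
    have "Min ?S > 0" using fin assms(5) by (subst Min_gr_iff) auto
    moreover have "\<psi> i j \<ge> Min ?S" if "i \<in> ?V" "j \<in> ?V" "i \<noteq> j" for i j
      using fin that by (intro Min_le) auto
    moreover have "Min ?S \<le> 1" using fin by (intro Min_le) auto
    ultimately show ?thesis using that by blast
  qed
  \<comment> \<open>Here \<open>\<theta>\<^sup>2\<close> exceeds \<open>1 - e\<^sup>2\<close> by
    \<open>e ^ 4 / 4\<close>. Writing the contraction factor as a square leaves room for the
    diameter of \<open>x\<close> to sit at \<theta> times the bound for \<open>Y\<close>, between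
    that bound and the one for \<open>U\<close>.\<close>
  define \<theta> where "\<theta> = 1 - e\<^sup>2 / 2"
  have "0 < e\<^sup>2" "e\<^sup>2 \<le> 1" using e by (auto simp: power_le_one)
  then have \<theta>: "0 < \<theta>" "\<theta> < 1" by (auto simp: \<theta>_def)
  have "1 - e\<^sup>2 \<le> \<theta>\<^sup>2"
    using e by (simp add: \<theta>_def power2_eq_square algebra_simps)
  then have U_contract: "norm (U n i t - U n j t) \<le> \<theta>\<^sup>2 * D"
    if "i \<in> ?V" "j \<in> ?V"
      and "\<And>k l. k \<in> ?V \<Longrightarrow> l \<in> ?V \<Longrightarrow> norm (Y n k (t - \<tau>) - Y n l (t - \<tau>)) \<le> D"
    for n i j t D
  proof -
    have "D \<ge> 0" using that(3)[OF that(1,1)] by simp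
    then have "(1 - e\<^sup>2) * D \<le> \<theta>\<^sup>2 * D"
      using \<open>1 - e\<^sup>2 \<le> \<theta>\<^sup>2\<close> by (rule mult_right_mono[rotated])
    moreover have "norm (U n i t - U n j t) \<le> (1 - e\<^sup>2) * D"
      unfolding U_def
      by (rule off_diagonal_average_diff_bound[OF assms(1,4) low e that(3,1,2)])
    ultimately show ?thesis by linarith
  qed

  define q where "q = exp (- \<tau>)"
  have q: "0 < q" "q < 1" using \<open>\<tau> > 0\<close> by (auto simp: q_def)
  \<comment> \<open>Over a full delay the old value keeps weight \<open>q\<close>, so a bound
    \<open>\<theta> * E\<close> relaxing towards \<open>\<theta>\<^sup>2 * E\<close> ends at
    \<open>\<theta> * (r * E)\<close>. Since \<open>r = 1 - (1 - q) * (1 - \<theta>)\<close>, the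
    next two inequalities place \<open>r\<close> between \<theta> and 1.\<close>
  define r where "r = q + (1 - q) * \<theta>"
  have "(1 - q) * (1 - \<theta>) < 1 * (1 - \<theta>)" "0 < (1 - q) * (1 - \<theta>)"
    using q \<theta> by (auto intro!: mult_strict_right_mono)
  then have r: "\<theta> < r" "r < 1" by (auto simp: r_def algebra_simps)

  \<comment> \<open>Bounds from the initial datum\<close>
  have Y0_bounded: "\<exists>B. \<forall>t\<in>{- \<tau>..0}. norm (Y 0 j t) \<le> B" if j: "j \<in> ?V" for j
  proof -
    obtain f' where f': "\<And>t. t \<in> {- \<tau>..0} \<Longrightarrow>
        (x0 j has_vector_derivative f' t) (at t within {- \<tau>..0})"
      and cont: "continuous_on {- \<tau>..0} f'"
      using assms(7) j unfolding C1_within_def by blast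
    have eq: "x j t = x0 j t" if "t \<in> {- \<tau>..0}" for t
      using assms(8) j that unfolding is_solution_def by blast
    have Y0: "Y 0 j t = x0 j t + \<sigma> *\<^sub>R f' t" if t: "t \<in> {- \<tau>..0}" for t
    proof -
      have "(x j has_vector_derivative f' t) (at t within {- \<tau>..0})"
        using has_vector_derivative_transform[OF t eq f'[OF t]] by blast
      then have "vector_derivative (x j) (at t within {- \<tau>..0}) = f' t"
        using vector_derivative_within_closed_interval[OF _ t] t \<open>\<tau> > 0\<close> by simp
      then show ?thesis using eq[OF t] by (simp add: Y_def)
    qed
    have "continuous_on {- \<tau>..0} (x0 j)"
      using f' has_vector_derivative_continuous continuous_on_eq_continuous_within by blast
    then have "continuous_on {- \<tau>..0} (\<lambda>t. x0 j t + \<sigma> *\<^sub>R f' t)"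
      using cont by (intro continuous_intros)
    then have "bounded ((\<lambda>t. x0 j t + \<sigma> *\<^sub>R f' t) ` {- \<tau>..0})"
      using compact_continuous_image compact_imp_bounded by blast
    then show ?thesis
      using Y0 by (auto simp: bounded_iff)
  qed
  then obtain B where B: "\<And>j t. j \<in> ?V \<Longrightarrow> t \<in> {- \<tau>..0} \<Longrightarrow> norm (Y 0 j t) \<le> B j"
    by metis
  \<comment> \<open>A sum of nonnegative terms dominates each of them. The division by \<theta>
    supplies the stronger bound \<open>\<theta> * C\<close> that the induction needs for
    \<open>x\<close> at time 0.\<close>
  define C where "C = (\<Sum>i\<in>?V. \<Sum>j\<in>?V. \<bar>B i\<bar> + \<bar>B j\<bar> + norm (x i 0 - x j 0) / \<theta>)"
  have C: "\<bar>B i\<bar> + \<bar>B j\<bar> + norm (x i 0 - x j 0) / \<theta> \<le> C" if "i \<in> ?V" "j \<in> ?V" for i j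
  proof -
    have "\<bar>B i\<bar> + \<bar>B j\<bar> + norm (x i 0 - x j 0) / \<theta>
        \<le> (\<Sum>j\<in>?V. \<bar>B i\<bar> + \<bar>B j\<bar> + norm (x i 0 - x j 0) / \<theta>)"
      using that \<theta> by (intro member_le_sum) auto
    also have "\<dots> \<le> C"
      unfolding C_def
      using that \<theta>
      by (intro member_le_sum[where f = "\<lambda>i. \<Sum>j\<in>?V. \<bar>B i\<bar> + \<bar>B j\<bar> + norm (x i 0 - x j 0) / \<theta>"])
        (auto intro!: sum_nonneg)
    finally show ?thesis .
  qed
  have C_nonneg: "C \<ge> 0"
    unfolding C_def using \<theta> by (auto intro!: sum_nonneg)

  \<comment> \<open>Geometric decay from one delay interval to the next\<close>
  have x_interval: "norm (x i t - x j t)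
      \<le> exp (real n * \<tau> - t) * (\<theta> * E) + (1 - exp (real n * \<tau> - t)) * (\<theta>\<^sup>2 * E)"
    if start: "norm (x i (real n * \<tau>) - x j (real n * \<tau>)) \<le> \<theta> * E"
      and prev: "\<And>k l s. k \<in> ?V \<Longrightarrow> l \<in> ?V \<Longrightarrow> s \<in> {(real n - 1) * \<tau>..real n * \<tau>} \<Longrightarrow>
          norm (Y n k s - Y n l s) \<le> E"
      and ij: "i \<in> ?V" "j \<in> ?V" and t: "t \<in> ?K n" for i j n t E
  proof -
    have "norm (x i t - x j t) \<le> exp (real n * \<tau> - t) * norm (x i (real n * \<tau>) - x j (real n * \<tau>))
        + (1 - exp (real n * \<tau> - t)) * (\<theta>\<^sup>2 * E)"
    proof (rule relaxation_bound[where g = "\<lambda>s. U n i s - U n j s", OF _ _ t])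
      fix s assume s: "s \<in> ?K n"
      show "((\<lambda>s. x i s - x j s) has_vector_derivative
          U n i s - U n j s - (x i s - x j s)) (at s within ?K n)"
        using has_vector_derivative_diff[OF x'[OF ij(1) s] x'[OF ij(2) s]]
        by (simp add: algebra_simps)
      show "norm (U n i s - U n j s) \<le> \<theta>\<^sup>2 * E"
        using s by (intro U_contract ij prev) (auto simp: algebra_simps)
    qed
    with start show ?thesis
      by (smt (verit) exp_gt_zero mult_left_mono)
  qed

  have x_le: "norm (x i t - x j t) \<le> \<theta> * E"
    if "norm (x i (real n * \<tau>) - x j (real n * \<tau>)) \<le> \<theta> * E"
      and "\<And>k l s. k \<in> ?V \<Longrightarrow> l \<in> ?V \<Longrightarrow> s \<in> {(real n - 1) * \<tau>..real n * \<tau>} \<Longrightarrow>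
          norm (Y n k s - Y n l s) \<le> E"
      and "i \<in> ?V" "j \<in> ?V" and "t \<in> ?K n" and "E \<ge> 0" for i j n t E
  proof -
    \<comment> \<open>The target of the relaxation lies below the starting bound, so the starting
      bound persists over the whole interval.\<close>
    have "\<theta>\<^sup>2 * E \<le> \<theta> * E"
      using \<theta> that(6) by (intro mult_right_mono) (auto simp: power2_eq_square)
    then have "(1 - exp (real n * \<tau> - t)) * (\<theta>\<^sup>2 * E) \<le> (1 - exp (real n * \<tau> - t)) * (\<theta> * E)"
      using that(5) by (intro mult_left_mono) auto
    with x_interval[OF that(1-5)] show ?thesis by (simp add: algebra_simps)
  qed

  \<comment> \<open>The invariant controls \<open>x\<close> only at the endpoint
    \<open>real n * \<tau>\<close>, but \<open>Y n\<close> on the whole interval before it, because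
    the delayed terms on \<open>?K n\<close> see that entire interval.\<close>
  have decay: "(\<forall>i\<in>?V. \<forall>j\<in>?V. norm (x i (real n * \<tau>) - x j (real n * \<tau>)) \<le> \<theta> * (C * r ^ n)) \<and>
      (\<forall>i\<in>?V. \<forall>j\<in>?V. \<forall>t\<in>{(real n - 1) * \<tau>..real n * \<tau>}. norm (Y n i t - Y n j t) \<le> C * r ^ n)"
    for n
  proof (induction n)
    case 0
    have "norm (x i 0 - x j 0) \<le> \<theta> * C" if "i \<in> ?V" "j \<in> ?V" for i j
      using C[OF that] \<theta> by (simp add: field_simps) (smt (verit) mult_nonneg_nonneg)
    moreover have "norm (Y 0 i t - Y 0 j t) \<le> C"
      if "i \<in> ?V" "j \<in> ?V" "t \<in> {- \<tau>..0}" for i j t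
    proof -
      have "norm (Y 0 i t - Y 0 j t) \<le> B i + B j"
        using B that by (intro order_trans[OF norm_triangle_ineq4] add_mono) auto
      also have "\<dots> \<le> \<bar>B i\<bar> + \<bar>B j\<bar> + norm (x i 0 - x j 0) / \<theta>"
        using \<theta> by (intro add_increasing2 add_mono) auto
      finally show ?thesis using C[OF that(1,2)] by linarith
    qed
    ultimately show ?case by simp
  next
    case (Suc n)
    define E where "E = C * r ^ n"
    have E: "E \<ge> 0" using C_nonneg r \<theta> by (simp add: E_def)
    have start: "norm (x i (real n * \<tau>) - x j (real n * \<tau>)) \<le> \<theta> * E"
      and prev: "\<And>k l s. k \<in> ?V \<Longrightarrow> l \<in> ?V \<Longrightarrow> s \<in> {(real n - 1) * \<tau>..real n * \<tau>} \<Longrightarrow>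
          norm (Y n k s - Y n l s) \<le> E"
      if "i \<in> ?V" "j \<in> ?V" for i j
      using Suc that by (auto simp: E_def)
    have "norm (x i (real (Suc n) * \<tau>) - x j (real (Suc n) * \<tau>)) \<le> \<theta> * (C * r ^ Suc n)"
      if ij: "i \<in> ?V" "j \<in> ?V" for i j
    proof -
      have "real (Suc n) * \<tau> \<in> ?K n" using \<open>\<tau> > 0\<close> by (simp add: algebra_simps)
      from x_interval[OF start[OF ij] prev[OF ij] ij this]
      have "norm (x i (real (Suc n) * \<tau>) - x j (real (Suc n) * \<tau>))
          \<le> q * (\<theta> * E) + (1 - q) * (\<theta>\<^sup>2 * E)"
        by (simp add: q_def algebra_simps)
      also have "\<dots> = \<theta> * (C * r ^ Suc n)"
        by (simp add: r_def E_def algebra_simps power2_eq_square)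
      finally show ?thesis .
    qed
    moreover have "norm (Y (Suc n) i t - Y (Suc n) j t) \<le> C * r ^ Suc n"
      if ij: "i \<in> ?V" "j \<in> ?V" and t: "t \<in> ?K n" for i j t
    proof -
      have "norm (U n i t - U n j t) \<le> \<theta>\<^sup>2 * E"
        using t by (intro U_contract ij prev[OF ij]) (auto simp: algebra_simps)
      also have "\<dots> \<le> \<theta> * E"
        using \<theta> E by (intro mult_right_mono) (auto simp: power2_eq_square)
      finally have u: "norm (U n i t - U n j t) \<le> \<theta> * E" .
      have "Y (Suc n) i t - Y (Suc n) j t
          = (1 - \<sigma>) *\<^sub>R (x i t - x j t) + \<sigma> *\<^sub>R (U n i t - U n j t)"
        unfolding Y_Suc[OF ij(1) t] Y_Suc[OF ij(2) t] by (simp add: algebra_simps)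
      also have "norm \<dots> \<le> (1 - \<sigma>) * norm (x i t - x j t) + \<sigma> * norm (U n i t - U n j t)"
        using \<sigma> by (intro order_trans[OF norm_triangle_ineq]) simp
      also have "\<dots> \<le> (1 - \<sigma>) * (\<theta> * E) + \<sigma> * (\<theta> * E)"
        using \<sigma> u x_le[OF start[OF ij] prev[OF ij] ij t E] by (intro add_mono mult_left_mono) auto
      also have "\<dots> = \<theta> * E"
        by (simp add: algebra_simps)
      \<comment> \<open>\<open>Y\<close> already shrinks by \<theta>; the slower rate
        \<open>r\<close> is imposed by the endpoint values of \<open>x\<close>.\<close>
      also have "\<dots> \<le> r * E"
        using r E by (intro mult_right_mono) auto
      also have "\<dots> = C * r ^ Suc n"
        by (simp add: E_def)
      finally show ?thesis .
    qed
    ultimately show ?case by (simp add: add.commute)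
  qed

  \<comment> \<open>Passage to continuous time and the limit\<close>
  have fin: "finite ((\<lambda>(i, j). norm (x i t - x j t)) ` (?V \<times> ?V))" for t by simp
  have d_nonneg: "0 \<le> d_x N x t" for t
  proof -
    have "norm (x I t - x I t) \<le> d_x N x t"
      unfolding d_x_def using assms(10) by (intro Max_ge[OF fin]) force
    then show ?thesis by simp
  qed
  have d_le: "d_x N x t \<le> C * r ^ nat \<lfloor>t / \<tau>\<rfloor>" if "t \<ge> 0" for t
  proof -
    \<comment> \<open>This is the index of a delay interval \<open>?K n\<close> containing
      \<open>t\<close>, and it tends to infinity with \<open>t\<close>.\<close>
    define n where "n = nat \<lfloor>t / \<tau>\<rfloor>"
    have "real n \<le> t / \<tau>" "t / \<tau> \<le> real n + 1"
      using that \<open>\<tau> > 0\<close> unfolding n_def by auto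
    then have t: "t \<in> ?K n" using \<open>\<tau> > 0\<close> by (simp add: field_simps)
    have E: "0 \<le> C * r ^ n" using C_nonneg r \<theta> by simp
    have "norm (x i t - x j t) \<le> C * r ^ n" if ij: "i \<in> ?V" "j \<in> ?V" for i j
    proof -
      have "norm (x i t - x j t) \<le> \<theta> * (C * r ^ n)"
        by (rule x_le[OF _ _ ij t E]) (use decay[of n] ij in auto)
      also have "\<dots> \<le> C * r ^ n"
        using E \<theta> by (intro mult_left_le_one_le) auto
      finally show ?thesis .
    qed
    then show ?thesis
      unfolding d_x_def n_def[symmetric] using assms(10)
      by (subst Max_le_iff[OF fin]) auto
  qed
  have floor_lim: "filterlim (\<lambda>t. nat \<lfloor>t / \<tau>\<rfloor>) sequentially at_top"
    unfolding filterlim_at_top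
  proof
    fix n
    show "\<forall>\<^sub>F t in at_top. n \<le> nat \<lfloor>t / \<tau>\<rfloor>"
      using eventually_ge_at_top[of "real n * \<tau>"]
    proof eventually_elim
      case (elim t)
      then have "real n \<le> t / \<tau>" using \<open>\<tau> > 0\<close> by (simp add: pos_le_divide_eq)
      then show ?case by (rule le_nat_floor)
    qed
  qed
  have "(\<lambda>n. r ^ n) \<longlonglongrightarrow> 0"
    using r \<theta> by (intro LIMSEQ_power_zero) auto
  from tendsto_mult_right_zero[OF filterlim_compose[OF this floor_lim], of C]
  have lim: "((\<lambda>t. C * r ^ nat \<lfloor>t / \<tau>\<rfloor>) \<longlongrightarrow> 0) at_top" .
  have "\<forall>\<^sub>F t in at_top. norm (d_x N x t) \<le> C * r ^ nat \<lfloor>t / \<tau>\<rfloor>"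
    using eventually_ge_at_top[of 0]
    by eventually_elim (use d_le d_nonneg in simp)
  then show ?thesis
    using lim by (rule Lim_null_comparison)
qed

end
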